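(* Let $\mu$ be a sampling-based inventory-agnostic policy and let $\overline{\mathrm{rev}}(\mu)$ be the total expected revenue of the sampling-based inventory-aware counterpart of $\mu$. Then $\overline{\mathrm{rev}}(\mu)\ge\mathrm{rev}(\mu)$.
   Context: Model. Products $\mathcal N=\{1,\dots,n\}$; product $i$ has revenue $r_i\ge 0$ and initial inventory $c_i\in\mathbb Z_+$. Customer types $\mathcal J=\{1,\dots,m\}$; time periods $\mathcal T=\{1,\dots,T\}$. At each period $t$ exactly one customer arrives, of type $j$ with probability $\lambda_{jt}\ge0$, $\sum_{j\in\mathcal J}\lambda_{jt}=1$; arrivals and choices at different periods are independent. If assortment $S\subseteq\mathcal N$ is offered to a type-$j$ customer, she chooses product $i$ with probability $\phi_{ij}(S)\ge0$ and chooses nothing with probability $1-\sum_{i\in\mathcal N}\phi_{ij}(S)\ge 0$; $\phi_{ij}(S)=0$ for $i\notin S$. Substitutability: $\phi_{ij}(S\cup\{\ell\})\le\phi_{ij}(S)$ for all $i\in S$, $\ell\notin S$, $j\in\mathcal J$, $S\subseteq\mathcal N$. Policies. A sampling-based inventory-agnostic policy $\mu$ is given by mutually independent random assortments $(S^\mu_{jt}: j\in\mathcal J, t\in\mathcal T)$, independent of arrivals and choices; if a type-$j$ customer arrives at period $t$, the assortment $S^\mu_{jt}$ is offered regardless of remaining inventories. If the customer chooses a product with no remaining inventory she leaves without a purchase; otherwise, if she chooses product $i$, one unit of its inventory is consumed and revenue $r_i$ is collected. $\mathrm{rev}(\mu)$ is the total expected revenue of $\mu$ over the selling horizon. Explicitly,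 with $\varphi^\mu_{it}=\sum_{j}\lambda_{jt}\sum_{S}\mathbb P\{S^\mu_{jt}=S\}\phi_{ij}(S)$ and, for each $i$, independent Bernoulli random variables $B^\mu_{it}$ ($t\in\mathcal T$) with parameters $\varphi^\mu_{it}$, $\mathrm{rev}(\mu)=\sum_{i}r_i\,\mathbb E\{\min\{c_i,\sum_{t\in\mathcal T}B^\mu_{it}\}\}$. Inventory-aware counterpart of $\mu$. If the remaining inventories at period $t$ are $x=(x_i:i\in\mathcal N)\in\mathbb Z_+^n$, let $\mathcal N(x)=\{i\in\mathcal N:x_i>0\}$. If a type-$j$ customer arrives at period $t$, the inventory-aware counterpart samples assortment $S$ with probability $\mathbb P\{S^\mu_{jt}=S\}$ and offers $S\cap\mathcal N(x)$. Its total expected revenue is $\overline J_1(c_1,\dots,c_n)$, where $\overline J_{T+1}\equiv 0$ and $$\overline J_t(x)=\sum_{j\in\mathcal J}\lambda_{jt}\,\mathbb E\Big\{\sum_{i\in\mathcal N}\phi_{ij}(S^\mu_{jt}\cap\mathcal N(x))\big(r_i+\overline J_{t+1}(x-e_i)\big)+\Big(1-\sum_{i\in\mathcal N}\phi_{ij}(S^\mu_{jt}\cap\mathcal N(x))\Big)\overline J_{t+1}(x)\Big\},$$ with $e_i$ the $i$-th unit vector (terms with zero choice probability, in particular those with $x_i=0$, are taken to be zero). *)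

theory Defs
  imports "HOL-Probability.Probability"
begin

locale assortment_model =
  fixes n m T :: nat
    and r :: "nat \<Rightarrow> real"
    and arr :: "nat \<Rightarrow> nat \<Rightarrow> real"  \<comment> \<open>\<open>arr j t\<close> is the arrival probability \<open>\<lambda>\<^sub>j\<^sub>t\<close>\<close>
    and \<phi> :: "nat \<Rightarrow> nat \<Rightarrow> nat set \<Rightarrow> real"  \<comment> \<open>product, customer type, offered assortment\<close>
  assumes revenue_nonneg: "\<And>i. i \<in> {1..n} \<Longrightarrow> r i \<ge> 0"
    and arr_nonneg: "\<And>j t. j \<in> {1..m} \<Longrightarrow> t \<in> {1..T} \<Longrightarrow> arr j t \<ge> 0"
    and arr_sum: "\<And>t. t \<in> {1..T} \<Longrightarrow> (\<Sum>j\<in>{1..m}. arr j t) = 1"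
    and choice_nonneg:
      "\<And>i j A. i \<in> {1..n} \<Longrightarrow> j \<in> {1..m} \<Longrightarrow> A \<subseteq> {1..n} \<Longrightarrow> \<phi> i j A \<ge> 0"
    and choice_sum_le: "\<And>j A. j \<in> {1..m} \<Longrightarrow> A \<subseteq> {1..n} \<Longrightarrow> (\<Sum>i\<in>{1..n}. \<phi> i j A) \<le> 1"
    and choice_not_offered:
      "\<And>i j A. i \<in> {1..n} \<Longrightarrow> j \<in> {1..m} \<Longrightarrow> A \<subseteq> {1..n} \<Longrightarrow> i \<notin> A \<Longrightarrow> \<phi> i j A = 0"
    and substitutable:
      "\<And>i j l A. A \<subseteq> {1..n} \<Longrightarrow> i \<in> A \<Longrightarrow> l \<in> {1..n} \<Longrightarrow> l \<notin> A \<Longrightarrow> j \<in> {1..m} \<Longrightarrow>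
         \<phi> i j (insert l A) \<le> \<phi> i j A"

text \<open>
  The probability space \<open>M\<close> carries only the sampled assortments. Their independence of the arrivals
  and choices enters through the product form of the choice probabilities and of the recursion
  below.
\<close>

locale sampling_policy = assortment_model n m T r arr \<phi> + prob_space M
  for n m T :: nat and r :: "nat \<Rightarrow> real"
    and arr :: "nat \<Rightarrow> nat \<Rightarrow> real" and \<phi> :: "nat \<Rightarrow> nat \<Rightarrow> nat set \<Rightarrow> real"
    and M :: "'w measure" +
  fixes S :: "nat \<Rightarrow> nat \<Rightarrow> 'w \<Rightarrow> nat set"
  assumes indep_assortments:
    "indep_vars (\<lambda>_. count_space (Pow {1..n})) (\<lambda>(j, t). S j t) ({1..m} \<times> {1..T})"

definition choice_prob ::
  "nat \<Rightarrow> nat \<Rightarrow> (nat \<Rightarrow> nat \<Rightarrow> real) \<Rightarrow> (nat \<Rightarrow> nat \<Rightarrow> nat set \<Rightarrow> real) \<Rightarrow>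
    'w measure \<Rightarrow> (nat \<Rightarrow> nat \<Rightarrow> 'w \<Rightarrow> nat set) \<Rightarrow> nat \<Rightarrow> nat \<Rightarrow> real" where
  "choice_prob n m arr \<phi> M S i t =
     (\<Sum>j\<in>{1..m}. arr j t *
        (\<Sum>A\<in>Pow {1..n}. measure M {\<omega> \<in> space M. S j t \<omega> = A} * \<phi> i j A))"

text \<open>
  \<open>Pi_pmf\<close> is the joint law of independent Bernoulli variables \<open>B t\<close> with parameters
  \<open>choice_prob n m arr \<phi> M S i t\<close>, which lie in \<open>[0, 1]\<close> for every sampling policy (see
  \<open>choice_prob_bounds\<close>); \<open>False\<close> is the value at indices outside \<open>{1..T}\<close>.
\<close>

definition agnostic_rev ::
  "nat \<Rightarrow> nat \<Rightarrow> nat \<Rightarrow> (nat \<Rightarrow> real) \<Rightarrow> (nat \<Rightarrow> nat) \<Rightarrow> (nat \<Rightarrow> nat \<Rightarrow> real) \<Rightarrow>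
    (nat \<Rightarrow> nat \<Rightarrow> nat set \<Rightarrow> real) \<Rightarrow> 'w measure \<Rightarrow> (nat \<Rightarrow> nat \<Rightarrow> 'w \<Rightarrow> nat set) \<Rightarrow> real" where
  "agnostic_rev n m T r c arr \<phi> M S =
     (\<Sum>i\<in>{1..n}. r i *
        measure_pmf.expectation
          (Pi_pmf {1..T} False (\<lambda>t. bernoulli_pmf (choice_prob n m arr \<phi> M S i t)))
          (\<lambda>B. real (min (c i) (\<Sum>t\<in>{1..T}. of_bool (B t)))))"

definition available :: "nat \<Rightarrow> (nat \<Rightarrow> nat) \<Rightarrow> nat set" where
  "available n x = {i \<in> {1..n}. x i > 0}"

text \<open>
  The inventory \<open>x - e\<^sub>i\<close> is \<open>x(i := x i - 1)\<close>. Truncated subtraction at \<open>x i = 0\<close> is harmless, since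
  then \<open>i \<notin> available n x\<close> and the choice probability multiplying that term vanishes.
\<close>

function aware_value ::
  "nat \<Rightarrow> nat \<Rightarrow> nat \<Rightarrow> (nat \<Rightarrow> real) \<Rightarrow> (nat \<Rightarrow> nat \<Rightarrow> real) \<Rightarrow>
    (nat \<Rightarrow> nat \<Rightarrow> nat set \<Rightarrow> real) \<Rightarrow> 'w measure \<Rightarrow> (nat \<Rightarrow> nat \<Rightarrow> 'w \<Rightarrow> nat set) \<Rightarrow>
    nat \<Rightarrow> (nat \<Rightarrow> nat) \<Rightarrow> real" where
  "aware_value n m T r arr \<phi> M S t x =
     (if t > T then 0
      else (\<Sum>j\<in>{1..m}. arr j t * (\<integral>\<omega>.
        (\<Sum>i\<in>{1..n}. \<phi> i j (S j t \<omega> \<inter> available n x) *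
             (r i + aware_value n m T r arr \<phi> M S (t + 1) (x(i := x i - 1))))
        + (1 - (\<Sum>i\<in>{1..n}. \<phi> i j (S j t \<omega> \<inter> available n x)))
            * aware_value n m T r arr \<phi> M S (t + 1) x \<partial>M)))"
  by pat_completeness auto
termination
  by (relation "Wellfounded.measure (\<lambda>(n, m, T, r, arr, \<phi>, M, S, t, x). T + 1 - t)") auto

declare aware_value.simps [simp del]

definition aware_rev ::
  "nat \<Rightarrow> nat \<Rightarrow> nat \<Rightarrow> (nat \<Rightarrow> real) \<Rightarrow> (nat \<Rightarrow> nat) \<Rightarrow> (nat \<Rightarrow> nat \<Rightarrow> real) \<Rightarrow>
    (nat \<Rightarrow> nat \<Rightarrow> nat set \<Rightarrow> real) \<Rightarrow> 'w measure \<Rightarrow> (nat \<Rightarrow> nat \<Rightarrow> 'w \<Rightarrow> nat set) \<Rightarrow> real" where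
  "aware_rev n m T r c arr \<phi> M S = aware_value n m T r arr \<phi> M S 1 c"

lemma (in sampling_policy) choice_prob_bounds:
  assumes i: "i \<in> {1..n}" and t: "t \<in> {1..T}"
  shows "0 \<le> choice_prob n m arr \<phi> M S i t" "choice_prob n m arr \<phi> M S i t \<le> 1"
proof -
  let ?q = "\<lambda>j. \<Sum>A\<in>Pow {1..n}. prob {\<omega> \<in> space M. S j t \<omega> = A} * \<phi> i j A"
  have q: "0 \<le> ?q j \<and> ?q j \<le> 1" if j: "j \<in> {1..m}" for j
  proof
    have \<phi>_le: "\<phi> i j A \<le> 1" if "A \<in> Pow {1..n}" for A
    proof -
      have "\<phi> i j A \<le> (\<Sum>i\<in>{1..n}. \<phi> i j A)"
        using that i j by (intro member_le_sum choice_nonneg) auto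
      also have "\<dots> \<le> 1" using that j by (intro choice_sum_le) auto
      finally show ?thesis .
    qed
    show "0 \<le> ?q j" using i j by (intro sum_nonneg mult_nonneg_nonneg choice_nonneg) auto
    have meas: "S j t \<in> measurable M (count_space (Pow {1..n}))"
      using indep_assortments j t unfolding indep_vars_def by auto
    have sets: "{\<omega> \<in> space M. S j t \<omega> = A} \<in> events" if "A \<in> Pow {1..n}" for A
    proof -
      have "S j t -` {A} \<inter> space M \<in> events"
        using that by (intro measurable_sets[OF meas]) auto
      moreover have "S j t -` {A} \<inter> space M = {\<omega> \<in> space M. S j t \<omega> = A}" by auto
      ultimately show ?thesis by simp
    qed
    have "?q j \<le> (\<Sum>A\<in>Pow {1..n}. prob {\<omega> \<in> space M. S j t \<omega> = A})"
      using \<phi>_le by (intro sum_mono mult_left_le) auto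
    also have "\<dots> = prob (\<Union>A\<in>Pow {1..n}. {\<omega> \<in> space M. S j t \<omega> = A})"
      using sets by (intro finite_measure_finite_Union[symmetric])
        (auto simp: disjoint_family_on_def)
    also have "\<dots> \<le> 1" by (rule prob_le_1)
    finally show "?q j \<le> 1" .
  qed
  show "0 \<le> choice_prob n m arr \<phi> M S i t"
    unfolding choice_prob_def using q t i
    by (intro sum_nonneg mult_nonneg_nonneg arr_nonneg choice_nonneg) auto
  have "choice_prob n m arr \<phi> M S i t \<le> (\<Sum>j\<in>{1..m}. arr j t)"
    unfolding choice_prob_def using q t
    by (intro sum_mono mult_left_le arr_nonneg) auto
  then show "choice_prob n m arr \<phi> M S i t \<le> 1" using arr_sum[OF t] by simp
qed

end

theory Submission
  imports Defs
begin

text \<open>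
  By backward induction on \<open>t\<close>, the value function of the inventory-aware policy dominates the
  separable function \<open>x \<mapsto> \<Sum>i. r i * E (min (x i) (\<Sum>s\<ge>t. B i s))\<close>. The marginal value of a unit
  of product \<open>i\<close> in this function is at most \<open>r i\<close>, so a sale of \<open>i\<close> never loses value, and by
  substitutability removing the sold-out products from an assortment only raises the choice
  probabilities of the products that are still available.
\<close>

text \<open>The index set is an argument so that the horizon can be cut down to the remaining
  periods \<open>{t..T}\<close> and grown again one period at a time.\<close>

definition expected_sales :: "('a \<Rightarrow> real) \<Rightarrow> 'a set \<Rightarrow> nat \<Rightarrow> real" where
  "expected_sales p A k =
     measure_pmf.expectation (Pi_pmf A False (\<lambda>t. bernoulli_pmf (p t)))
       (\<lambda>B. real (min k (\<Sum>t\<in>A. of_bool (B t))))"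

lemma expected_sales_0 [simp]: "expected_sales p A 0 = 0"
  by (simp add: expected_sales_def)

lemma expected_sales_empty [simp]: "expected_sales p {} k = 0"
  by (simp add: expected_sales_def)

lemma integrable_truncated_pmf: "integrable (measure_pmf D) (\<lambda>B. real (min k (g B)))"
  by (rule measure_pmf.integrable_const_bound[where B = "real k"]) auto

lemma expected_sales_Suc_le: "expected_sales p A (Suc k) \<le> 1 + expected_sales p A k"
proof -
  let ?D = "Pi_pmf A False (\<lambda>t. bernoulli_pmf (p t))"
  have "expected_sales p A (Suc k) \<le>
      measure_pmf.expectation ?D (\<lambda>B. 1 + real (min k (\<Sum>t\<in>A. of_bool (B t))))"
    unfolding expected_sales_def
    by (intro integral_mono integrable_truncated_pmf Bochner_Integration.integrable_add) auto
  also have "\<dots> = 1 + expected_sales p A k"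
    unfolding expected_sales_def
    by (subst Bochner_Integration.integral_add) (auto intro: integrable_truncated_pmf)
  finally show ?thesis .
qed

text \<open>Condition on the outcome in period \<open>a\<close>: success sells one unit and leaves
  \<open>k\<close> for the periods in \<open>A\<close>, failure leaves all
  \<open>Suc k\<close>.\<close>

lemma expected_sales_insert:
  assumes A: "finite A" "a \<notin> A" and p: "0 \<le> p a" "p a \<le> 1"
  shows "expected_sales p (insert a A) (Suc k) =
           p a * (1 + expected_sales p A k) + (1 - p a) * expected_sales p A (Suc k)"
proof -
  let ?D = "Pi_pmf A False (\<lambda>t. bernoulli_pmf (p t))"
  let ?N = "\<lambda>B. \<Sum>t\<in>A. of_bool (B t) :: nat"
  have upd: "(\<Sum>t\<in>insert a A. of_bool ((B(a := b)) t)) = of_bool b + ?N B" for B b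
  proof -
    have "(\<Sum>t\<in>A. of_bool ((B(a := b)) t)) = ?N B" using A by (intro sum.cong) auto
    then show ?thesis by (simp only: sum.insert[OF A] fun_upd_same)
  qed
  \<comment> \<open>Finite support lets \<open>pmf_expectation_bind\<close> write the expectation as
    a finite sum over the outcome \<open>b\<close>.\<close>
  have fin: "finite (set_pmf ?D)"
    by (rule finite_subset[OF set_Pi_pmf_subset'[OF A(1)] finite_PiE_dflt]) (use A in auto)
  have "Pi_pmf (insert a A) False (\<lambda>t. bernoulli_pmf (p t)) =
      bernoulli_pmf (p a) \<bind> (\<lambda>b. map_pmf (\<lambda>B. B(a := b)) ?D)"
    by (simp add: Pi_pmf_insert'[OF A] map_pmf_def)
  then have "expected_sales p (insert a A) (Suc k) =
      (\<Sum>b\<in>UNIV. pmf (bernoulli_pmf (p a)) b * measure_pmf.expectation ?D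
        (\<lambda>B. real (min (Suc k) (\<Sum>t\<in>insert a A. of_bool ((B(a := b)) t)))))"
    unfolding expected_sales_def using fin
    by (simp only:) (subst pmf_expectation_bind[where A = UNIV], auto)
  \<comment> \<open>For \<open>b = True\<close> this uses
    \<open>min (Suc k) (1 + s) = 1 + min k s\<close>.\<close>
  also have "\<dots> = p a * measure_pmf.expectation ?D (\<lambda>B. 1 + real (min k (?N B)))
      + (1 - p a) * measure_pmf.expectation ?D (\<lambda>B. real (min (Suc k) (?N B)))"
    using p by (simp only: upd) (simp add: UNIV_bool del: sum_of_bool_eq)
  also have "measure_pmf.expectation ?D (\<lambda>B. 1 + real (min k (?N B))) = 1 + expected_sales p A k"
    unfolding expected_sales_def
    by (subst Bochner_Integration.integral_add) (auto intro: integrable_truncated_pmf)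
  finally show ?thesis by (simp add: expected_sales_def)
qed

text \<open>Bridges the two models: the recursion of \<open>aware_value\<close> integrates over
  sampled assortments, whereas \<open>choice_prob\<close> sums over their probabilities.\<close>

lemma (in prob_space) expectation_finite_valued:
  fixes f :: "'b \<Rightarrow> real"
  assumes X: "X \<in> measurable M (count_space F)" and F: "finite F"
  shows "(\<integral>\<omega>. f (X \<omega>) \<partial>M) = (\<Sum>a\<in>F. prob {\<omega> \<in> space M. X \<omega> = a} * f a)"
proof -
  have sets: "{\<omega> \<in> space M. X \<omega> = a} \<in> events" if "a \<in> F" for a
    using measurable_sets[OF X, of "{a}"] that
    by (simp add: vimage_def Int_def conj_commute)
  have "(\<integral>\<omega>. f (X \<omega>) \<partial>M) =
      (\<integral>\<omega>. (\<Sum>a\<in>F. indicator {\<omega> \<in> space M. X \<omega> = a} \<omega> * f a) \<partial>M)"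
  proof (rule Bochner_Integration.integral_cong[OF refl])
    fix \<omega> assume \<omega>: "\<omega> \<in> space M"
    then have "X \<omega> \<in> F" using measurable_space[OF X] by auto
    then have "f (X \<omega>) = (\<Sum>a\<in>F. if X \<omega> = a then f a else 0)" using F by simp
    also have "\<dots> = (\<Sum>a\<in>F. indicator {\<omega> \<in> space M. X \<omega> = a} \<omega> * f a)"
      using \<omega> by (intro sum.cong) auto
    finally show "f (X \<omega>) = (\<Sum>a\<in>F. indicator {\<omega> \<in> space M. X \<omega> = a} \<omega> * f a)" .
  qed
  also have "\<dots> = (\<Sum>a\<in>F. prob {\<omega> \<in> space M. X \<omega> = a} * f a)"
    using sets by (subst Bochner_Integration.integral_sum) (auto simp: Int_absorb2 integrable_indicator_iff less_top[symmetric])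
  finally show ?thesis .
qed

text \<open>Substitutability adds a single product; induction over a finite set of added products
  extends it to arbitrary inclusions.\<close>

lemma (in assortment_model) choice_antimono:
  assumes "A \<subseteq> C" "C \<subseteq> {1..n}" "i \<in> A" "j \<in> {1..m}"
  shows "\<phi> i j C \<le> \<phi> i j A"
proof -
  have "\<phi> i j (A \<union> D) \<le> \<phi> i j A" if "finite D" "D \<subseteq> {1..n}" for D
    using that
  proof (induction D)
    case (insert l D)
    have "\<phi> i j (insert l (A \<union> D)) \<le> \<phi> i j (A \<union> D)"
    proof (cases "l \<in> A \<union> D")
      case False
      then show ?thesis using assms insert.prems by (intro substitutable) auto
    qed (simp add: insert_absorb)
    then show ?case using insert by simp
  qed simp
  from this[of C] show ?thesis
    using assms finite_subset[of C "{1..n}"] by (simp add: Un_absorb1)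
qed

context sampling_policy
begin

abbreviation sales_value :: "nat \<Rightarrow> (nat \<Rightarrow> nat) \<Rightarrow> real" where
  "sales_value t x \<equiv>
     (\<Sum>i\<in>{1..n}. r i * expected_sales (choice_prob n m arr \<phi> M S i) {t..T} (x i))"

lemma measurable_assortment:
  "j \<in> {1..m} \<Longrightarrow> t \<in> {1..T} \<Longrightarrow> S j t \<in> measurable M (count_space (Pow {1..n}))"
  using indep_assortments unfolding indep_vars_def by auto

text \<open>Here \<open>\<Delta> i\<close> is the opportunity cost of a unit of \<open>i\<close>.
  Conditioning on period \<open>t\<close> separately for each product gives the recursion; one more
  unit yields at most one more sale, hence the bound by \<open>r i\<close>.\<close>

lemma sales_value_step:
  fixes x t
  defines "\<Delta> \<equiv> \<lambda>i. sales_value (Suc t) x - sales_value (Suc t) (x(i := x i - 1))"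
  assumes t: "t \<in> {1..T}"
  shows "sales_value t x = sales_value (Suc t) x +
           (\<Sum>i\<in>available n x. (r i - \<Delta> i) * choice_prob n m arr \<phi> M S i t)"
    and "\<And>i. i \<in> available n x \<Longrightarrow> \<Delta> i \<le> r i"
proof -
  let ?e = "\<lambda>t i. expected_sales (choice_prob n m arr \<phi> M S i) {t..T}"
  \<comment> \<open>By separability, removing a unit of \<open>i\<close> changes only the
    \<open>i\<close>-th summand.\<close>
  have \<Delta>: "\<Delta> i = r i * (?e (Suc t) i (x i) - ?e (Suc t) i (x i - 1))" if "i \<in> {1..n}" for i
  proof -
    have "\<Delta> i = (\<Sum>l\<in>{1..n}. if l = i
        then r i * (?e (Suc t) i (x i) - ?e (Suc t) i (x i - 1)) else 0)"
      unfolding \<Delta>_def sum_subtractf[symmetric]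
      by (intro sum.cong) (auto simp: algebra_simps)
    then show ?thesis using that by simp
  qed
  have ins: "{t..T} = insert t {Suc t..T}" using t by auto
  have step: "r i * ?e t i (x i) = r i * ?e (Suc t) i (x i) +
      (if i \<in> available n x then (r i - \<Delta> i) * choice_prob n m arr \<phi> M S i t else 0)"
    if i: "i \<in> {1..n}" for i
  \<comment> \<open>A sold-out product contributes zero on both sides; otherwise the recursion for
    \<open>Suc k\<close> applies.\<close>
  proof (cases "x i")
    case (Suc k)
    then have "i \<in> available n x" using i by (simp add: available_def)
    moreover have eq: "?e t i (Suc k) = choice_prob n m arr \<phi> M S i t * (1 + ?e (Suc t) i k) +
        (1 - choice_prob n m arr \<phi> M S i t) * ?e (Suc t) i (Suc k)"
      unfolding ins using choice_prob_bounds[OF i t] by (intro expected_sales_insert) auto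
    ultimately show ?thesis unfolding Suc eq by (simp add: \<Delta>[OF i] Suc algebra_simps)
  qed (simp add: available_def)
  have "available n x = {i \<in> {1..n}. i \<in> available n x}" by (auto simp: available_def)
  then have "(\<Sum>i\<in>available n x. (r i - \<Delta> i) * choice_prob n m arr \<phi> M S i t) = (\<Sum>i\<in>{1..n}.
      if i \<in> available n x then (r i - \<Delta> i) * choice_prob n m arr \<phi> M S i t else 0)"
    using sum.inter_filter[of "{1..n}" _ "\<lambda>i. i \<in> available n x"] by simp
  then show "sales_value t x = sales_value (Suc t) x +
      (\<Sum>i\<in>available n x. (r i - \<Delta> i) * choice_prob n m arr \<phi> M S i t)"
    using step by (simp add: sum.distrib)
  show "\<Delta> i \<le> r i" if "i \<in> available n x" for i
  proof -
    from that have i: "i \<in> {1..n}" and x: "Suc (x i - 1) = x i" by (auto simp: available_def)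
    have "?e (Suc t) i (x i) - ?e (Suc t) i (x i - 1) \<le> 1"
      using expected_sales_Suc_le[of "choice_prob n m arr \<phi> M S i" "{Suc t..T}" "x i - 1"] x
      by simp
    then have "\<Delta> i \<le> r i * 1" unfolding \<Delta>[OF i] by (intro mult_left_mono revenue_nonneg i)
    then show ?thesis by simp
  qed
qed

lemma sales_value_le_aware_value:
  assumes "1 \<le> t" "t \<le> Suc T"
  shows "sales_value t x \<le> aware_value n m T r arr \<phi> M S t x"
  using assms(2,1)
\<comment> \<open>At \<open>Suc T\<close> no period remains and both sides vanish. The inventory is
  arbitrary because the step compares values at \<open>x\<close> and after each possible
  sale.\<close>
proof (induction t arbitrary: x rule: inc_induct)
  case base
  then show ?case by (simp add: aware_value.simps)
next
  case (step t)
  let ?J = "aware_value n m T r arr \<phi> M S (Suc t)"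
  let ?N = "available n x"
  let ?q = "\<lambda>j A. prob {\<omega> \<in> space M. S j t \<omega> = A}"
  define V where "V = sales_value (Suc t)"
  define d where "d i = r i - (V x - V (x(i := x i - 1)))" for i
  define F where "F j A = (\<Sum>i\<in>{1..n}. \<phi> i j (A \<inter> ?N) * (r i + ?J (x(i := x i - 1)))) +
      (1 - (\<Sum>i\<in>{1..n}. \<phi> i j (A \<inter> ?N))) * ?J x" for j A
  have t: "t \<in> {1..T}" using step by auto
  have IH: "V y \<le> ?J y" for y using step.IH unfolding V_def by simp
  have N: "?N \<subseteq> {1..n}" "finite ?N" by (auto simp: available_def)
  have d: "d i \<ge> 0" if "i \<in> ?N" for i
    using sales_value_step(2)[OF t that] unfolding d_def V_def by linarith
  \<comment> \<open>The comparison is made for each fixed type and sampled assortment, before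
    averaging. On the left the full \<open>A\<close> is offered, on the right only its products in
    stock.\<close>
  have F: "V x + (\<Sum>i\<in>?N. d i * \<phi> i j A) \<le> F j A" if j: "j \<in> {1..m}" and A: "A \<subseteq> {1..n}" for j A
  proof -
    have AN: "A \<inter> ?N \<subseteq> {1..n}" using A by auto
    have "(\<Sum>i\<in>?N. d i * \<phi> i j A) \<le> (\<Sum>i\<in>?N. d i * \<phi> i j (A \<inter> ?N))"
    proof (intro sum_mono mult_left_mono d)
      fix i assume i: "i \<in> ?N"
      show "\<phi> i j A \<le> \<phi> i j (A \<inter> ?N)"
      proof (cases "i \<in> A")
        case True
        then show ?thesis using i A j by (intro choice_antimono) auto
      next
        case False
        then show ?thesis using i N(1) A AN j by (simp add: choice_not_offered subset_iff)
      qed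
    qed
    \<comment> \<open>Sold-out products lie outside \<open>A \<inter> ?N\<close> and have choice
      probability zero, so the sign of their \<open>d i\<close> is immaterial.\<close>
    also have "\<dots> = (\<Sum>i\<in>{1..n}. d i * \<phi> i j (A \<inter> ?N))"
      using N AN j by (intro sum.mono_neutral_left) (auto intro!: choice_not_offered)
    finally have "V x + (\<Sum>i\<in>?N. d i * \<phi> i j A) \<le>
        V x + (\<Sum>i\<in>{1..n}. d i * \<phi> i j (A \<inter> ?N))" by simp
    also have "\<dots> = (\<Sum>i\<in>{1..n}. \<phi> i j (A \<inter> ?N) * (r i + V (x(i := x i - 1)))) +
        (1 - (\<Sum>i\<in>{1..n}. \<phi> i j (A \<inter> ?N))) * V x"
      by (simp add: d_def algebra_simps sum.distrib sum_subtractf sum_distrib_left)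
    \<comment> \<open>The choice and no-choice probabilities are nonnegative weights, so replacing
      \<open>V\<close> by the larger \<open>?J\<close> can only increase the sum.\<close>
    also have "\<dots> \<le> F j A"
      unfolding F_def using IH choice_nonneg[OF _ j AN] choice_sum_le[OF j AN]
      by (intro add_mono sum_mono mult_left_mono) auto
    finally show ?thesis .
  qed
  have q: "(\<Sum>A\<in>Pow {1..n}. ?q j A) = 1" if "j \<in> {1..m}" for j
    using expectation_finite_valued[OF measurable_assortment[OF that t], of "\<lambda>_. 1"]
    by (simp add: prob_space)
  have "sales_value t x = V x + (\<Sum>i\<in>?N. d i * choice_prob n m arr \<phi> M S i t)"
    unfolding V_def d_def by (rule sales_value_step(1)[OF t])
  also have "(\<Sum>i\<in>?N. d i * choice_prob n m arr \<phi> M S i t) =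
      (\<Sum>j\<in>{1..m}. arr j t * (\<Sum>A\<in>Pow {1..n}. ?q j A * (\<Sum>i\<in>?N. d i * \<phi> i j A)))"
    unfolding choice_prob_def sum_distrib_left
    by (subst sum.swap, intro sum.cong refl, subst sum.swap)
      (auto intro!: sum.cong simp: algebra_simps)
  \<comment> \<open>Arrival and sampling probabilities each sum to one, so \<open>V x\<close> can be
    moved inside both averages to meet the bound \<open>F\<close>.\<close>
  also have "V x + \<dots> = (\<Sum>j\<in>{1..m}. arr j t * V x) + \<dots>"
    using arr_sum[OF t] by (simp flip: sum_distrib_right)
  also have "\<dots> = (\<Sum>j\<in>{1..m}. arr j t *
      (\<Sum>A\<in>Pow {1..n}. ?q j A * (V x + (\<Sum>i\<in>?N. d i * \<phi> i j A))))"
    unfolding sum.distrib[symmetric]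
  proof (rule sum.cong[OF refl])
    fix j assume "j \<in> {1..m}"
    then have "V x = (\<Sum>A\<in>Pow {1..n}. ?q j A * V x)" using q by (simp flip: sum_distrib_right)
    then show "arr j t * V x +
        arr j t * (\<Sum>A\<in>Pow {1..n}. ?q j A * (\<Sum>i\<in>?N. d i * \<phi> i j A)) =
        arr j t * (\<Sum>A\<in>Pow {1..n}. ?q j A * (V x + (\<Sum>i\<in>?N. d i * \<phi> i j A)))"
      by (simp add: distrib_left sum.distrib)
  qed
  also have "\<dots> \<le> (\<Sum>j\<in>{1..m}. arr j t * (\<Sum>A\<in>Pow {1..n}. ?q j A * F j A))"
    using F arr_nonneg t by (intro sum_mono mult_left_mono) auto
  also have "\<dots> = (\<Sum>j\<in>{1..m}. arr j t * (\<integral>\<omega>. F j (S j t \<omega>) \<partial>M))"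
    using t by (intro sum.cong refl)
      (simp add: expectation_finite_valued[OF measurable_assortment])
  also have "\<dots> = aware_value n m T r arr \<phi> M S t x"
    \<comment> \<open>The third occurrence is the right-hand side; the first two are the next-period
      values inside \<open>F\<close>, which must stay folded.\<close>
    using t unfolding F_def by (subst (3) aware_value.simps) simp
  finally show ?case .
qed

end

theorem proposition5p1:
  fixes n m T :: nat
    and r :: "nat \<Rightarrow> real" and c :: "nat \<Rightarrow> nat"
    and arr :: "nat \<Rightarrow> nat \<Rightarrow> real"
    and \<phi> :: "nat \<Rightarrow> nat \<Rightarrow> nat set \<Rightarrow> real"
    and M :: "'w measure" and S :: "nat \<Rightarrow> nat \<Rightarrow> 'w \<Rightarrow> nat set"
  assumes "sampling_policy n m T r arr \<phi> M S"
  shows "aware_rev n m T r c arr \<phi> M S \<ge> agnostic_rev n m T r c arr \<phi> M S"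
proof -
  interpret sampling_policy n m T r arr \<phi> M S by (fact assms)
  show ?thesis
    \<comment> \<open>At \<open>t = 1\<close> the remaining periods are the whole horizon, so the
      lower bound is exactly \<open>agnostic_rev\<close>.\<close>
    using sales_value_le_aware_value[of 1 c]
    by (simp add: aware_rev_def agnostic_rev_def expected_sales_def)
qed

end
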